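(* Let $G=(V,E,w)$ be a weighted semi-bipartite graph with parts $V_1$ and $V_2$, where $|V_1|=|V_2|+1$. Let $P=\{p_j\}_{j=1}^k\subseteq V_1$. Suppose that for all $i$ there exists a perfect matching in $G-p_i$. Then, if the weights $w_{uv}$ are chosen randomly from a continuous distribution (meaning that no value has positive probability) for all $uv\in E$, we have $\det(A_{G-p_j})\neq 0$ for all $p_j$ with probability $1$.
   Context: Graphs are finite. A graph is semi-bipartite with parts $V_1,V_2$ if its vertex set is $V=V_1\sqcup V_2$ and there are no edges (including self-loops) within $V_1$. Edges between $V_1$ and $V_2$, and edges and self-loops within $V_2$, are allowed. A weighted graph $G=(V,E,w)$ has weights $w_{uv}\in\mathbb{C}$ with $w_{uv}=\overline{w_{vu}}$ and $w_{uv}=0$ whenever $uv\notin E$. The adjacency matrix $A_G$ is the matrix, indexed by the vertices, with entries $(A_G)_{uv}=w_{uv}$. $G-p$ denotes $G$ with the vertex $p$ and all edges incident to $p$ removed. A perfect matching in a graph is a set of disjoint edges that covers all the vertices. *)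

theory Defs
  imports "HOL-Probability.Probability" "Jordan_Normal_Form.Determinant"
begin

text \<open>Undirected graphs: an edge joining \<open>u\<close> and \<open>v\<close> is the set \<open>{u, v}\<close>, so a self-loop
  at \<open>v\<close> is the singleton \<open>{v}\<close>.\<close>

record 'v graph =
  verts :: "'v set"
  edges :: "'v set set"

definition finite_graph :: "'v graph \<Rightarrow> bool" where
  "finite_graph G \<longleftrightarrow>
     finite (verts G) \<and> (\<forall>e\<in>edges G. \<exists>u\<in>verts G. \<exists>v\<in>verts G. e = {u, v})"

definition semi_bipartite :: "'v graph \<Rightarrow> 'v set \<Rightarrow> 'v set \<Rightarrow> bool" where
  "semi_bipartite G V1 V2 \<longleftrightarrow>
     finite_graph G \<and> verts G = V1 \<union> V2 \<and> V1 \<inter> V2 = {} \<and>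
     (\<forall>u\<in>V1. \<forall>v\<in>V1. {u, v} \<notin> edges G)"

definition delete_vertex :: "'v graph \<Rightarrow> 'v \<Rightarrow> 'v graph" where
  "delete_vertex G p = \<lparr>verts = verts G - {p}, edges = {e \<in> edges G. p \<notin> e}\<rparr>"

definition perfect_matching :: "'v graph \<Rightarrow> 'v set set \<Rightarrow> bool" where
  "perfect_matching G F \<longleftrightarrow> F \<subseteq> edges G \<and> disjoint F \<and> \<Union>F = verts G"

definition hermitian_weights :: "'v graph \<Rightarrow> ('v \<Rightarrow> 'v \<Rightarrow> complex) \<Rightarrow> bool" where
  "hermitian_weights G w \<longleftrightarrow>
     (\<forall>u\<in>verts G. \<forall>v\<in>verts G. w u v = cnj (w v u) \<and> ({u, v} \<notin> edges G \<longrightarrow> w u v = 0))"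

text \<open>The library's matrices are indexed by an initial segment of the naturals, so the vertices
  are listed in some order \<open>vs\<close>; the determinant does not depend on the order.  No separate
  weight function is needed after deleting a vertex: the pairs of remaining vertices keep their
  weights.\<close>

definition vertex_list :: "'v graph \<Rightarrow> 'v list \<Rightarrow> bool" where
  "vertex_list G vs \<longleftrightarrow> distinct vs \<and> set vs = verts G"

definition adjacency_matrix :: "'v list \<Rightarrow> ('v \<Rightarrow> 'v \<Rightarrow> complex) \<Rightarrow> complex mat" where
  "adjacency_matrix vs w =
     Matrix.mat (length vs) (length vs) (\<lambda>(i, j). w (vs ! i) (vs ! j))"

definition continuous_distribution :: "complex measure \<Rightarrow> bool" where
  "continuous_distribution D \<longleftrightarrow> (\<forall>z. emeasure D {z} = 0)"

text \<open>Independence is over undirected edges, as the weights \<open>w u v\<close> and \<open>w v u\<close> of one edge are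
  conjugate to each other.  An orientation \<open>ends\<close> selects one of the two for each edge; since
  conjugation is measurable, which one is selected is immaterial.  A loop carries a real weight,
  so its distribution is concentrated on the real line; therefore only the absence of atoms in
  the complex plane is required, not a density.  The distributions of different edges may
  differ.\<close>

definition random_weights ::
    "'w measure \<Rightarrow> 'v graph \<Rightarrow> ('w \<Rightarrow> 'v \<Rightarrow> 'v \<Rightarrow> complex) \<Rightarrow> bool" where
  "random_weights M G w \<longleftrightarrow>
     prob_space M \<and>
     (\<forall>\<omega>\<in>space M. hermitian_weights G (w \<omega>)) \<and>
     (\<exists>ends :: 'v set \<Rightarrow> 'v \<times> 'v.
        (\<forall>e\<in>edges G. e = {fst (ends e), snd (ends e)}) \<and>
        prob_space.indep_vars M (\<lambda>e. borel)
          (\<lambda>e \<omega>. w \<omega> (fst (ends e)) (snd (ends e))) (edges G)) \<and>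
     (\<forall>u v. {u, v} \<in> edges G \<longrightarrow>
        continuous_distribution (distr M borel (\<lambda>\<omega>. w \<omega> u v)))"

end

theory Submission
  imports Defs
begin

text \<open>As \<open>V1\<close> spans no edge, the adjacency matrix of \<open>G - p\<close> has a zero block on \<open>V1 - {p}\<close>, which has
  as many vertices as \<open>V2\<close>; so it is singular only if the square block \<open>B\<close> of weights between
  \<open>V1 - {p}\<close> and \<open>V2\<close> is.  For the same reason a perfect matching of \<open>G - p\<close> pairs \<open>V1 - {p}\<close> with
  \<open>V2\<close>, and weights \<open>1\<close> on the matching, \<open>0\<close> elsewhere, make \<open>B\<close> the identity.  Starting from
  these weights, replace the edge weights by the random ones, one edge at a time.  Each edge
  meets at most one entry of \<open>B\<close>, in which \<open>det B\<close> is affine; so as long as \<open>det B \<noteq> 0\<close> before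
  a replacement, at most one new value makes it vanish, and this value has probability \<open>0\<close>.\<close>

unbundle no vec_syntax

section \<open>Almost sure non-vanishing under product measures\<close>

text \<open>Tonelli for the indicator of the exceptional set, whence the measurability assumption:
  the inner integral over coordinate \<open>i\<close> vanishes for almost every
  \<open>x\<close>.\<close>

lemma (in product_sigma_finite) AE_PiM_insertI:
  assumes I: "finite I" "i \<notin> I"
    and m: "{x \<in> space (Pi\<^sub>M (insert i I) M). \<not> Q x} \<in> sets (Pi\<^sub>M (insert i I) M)"
    and ae: "AE x in Pi\<^sub>M I M. AE c in M i. Q (x(i := c))"
  shows "AE x in Pi\<^sub>M (insert i I) M. Q x"
proof -
  define N where "N = {x \<in> space (Pi\<^sub>M (insert i I) M). \<not> Q x}"
  have N: "N \<in> sets (Pi\<^sub>M (insert i I) M)"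
    using m by (simp add: N_def)
  have "emeasure (Pi\<^sub>M (insert i I) M) N =
      (\<integral>\<^sup>+ x. (\<integral>\<^sup>+ c. indicator N (x(i := c)) \<partial>M i) \<partial>Pi\<^sub>M I M)"
    using N product_nn_integral_insert[OF I, of "indicator N"] by simp
  also have "\<dots> = (\<integral>\<^sup>+ x. 0 \<partial>Pi\<^sub>M I M)"
  proof (rule nn_integral_cong_AE)
    show "AE x in Pi\<^sub>M I M. (\<integral>\<^sup>+ c. indicator N (x(i := c)) \<partial>M i) = 0"
      using ae
    proof eventually_elim
      case (elim x)
      then have "(\<integral>\<^sup>+ c. indicator N (x(i := c)) \<partial>M i) = (\<integral>\<^sup>+ c. 0 \<partial>M i)"
        by (intro nn_integral_cong_AE) (auto simp: N_def indicator_def)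
      then show ?case by simp
    qed
  qed
  finally have "emeasure (Pi\<^sub>M (insert i I) M) N = 0" by simp
  then show ?thesis
    using N by (intro AE_I[of _ _ N]) (auto simp: N_def)
qed

text \<open>The replacement argument in abstract form: starting from \<open>x0\<close>, coordinates
  are randomised one at a time. On a line parallel to an axis, one point with
  \<open>f \<noteq> 0\<close> leaves only countably many zeros, and an atomless law gives these
  probability 0.\<close>

lemma AE_PiM_nonzero:
  fixes f :: "('i \<Rightarrow> 'a :: t1_space) \<Rightarrow> 'b :: {t1_space, zero}"
  assumes "finite I"
    and prob: "\<And>i. prob_space (D i)"
    and borel: "\<And>i. sets (D i) = sets borel"
    and null: "\<And>i c. i \<in> I \<Longrightarrow> emeasure (D i) {c} = 0"
    and "f \<in> borel_measurable (Pi\<^sub>M I (\<lambda>_. borel))"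
    and "x0 \<in> extensional I" "f x0 \<noteq> 0"
    and "\<And>i x. i \<in> I \<Longrightarrow> f x \<noteq> 0 \<Longrightarrow> countable {c. f (x(i := c)) = 0}"
  shows "AE x in Pi\<^sub>M I D. f x \<noteq> 0"
  using assms(1) null assms(5-)
proof (induction I arbitrary: f x0 rule: finite_induct)
  case empty
  then show ?case
    \<comment> \<open>The product over no coordinates has a single point; being extensional,
      \<open>x0\<close> is that point.\<close>
    by (subst AE_cong_simp[OF refl, of _ _ "\<lambda>_. f x0 \<noteq> 0"]) (auto simp: space_PiM)
next
  case (insert i I)
  interpret prod: product_prob_space D
    using prob by (intro product_prob_spaceI)
  have sets_PiM: "sets (Pi\<^sub>M J D) = sets (Pi\<^sub>M J (\<lambda>_. borel))" for J
    by (intro sets_PiM_cong refl borel)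
  note measurable_PiM = measurable_cong_sets[OF sets_PiM refl]
  \<comment> \<open>Coordinate \<open>i\<close> stays frozen at its starting value while the
    induction hypothesis randomises the others.\<close>
  define g where "g x = f (x(i := x0 i))" for x
  have "AE x in Pi\<^sub>M I D. g x \<noteq> 0"
  proof (rule insert.IH)
    show "g \<in> borel_measurable (Pi\<^sub>M I (\<lambda>_. borel))"
      unfolding g_def
      by (rule measurable_compose[OF _ insert.prems(2)], rule measurable_fun_upd[of _ I]) auto
    \<comment> \<open>The starting point over \<open>I\<close> must forget coordinate
      \<open>i\<close>; \<open>g\<close> puts the value \<open>x0 i\<close> back.\<close>
    show "x0(i := undefined) \<in> extensional I" "g (x0(i := undefined)) \<noteq> 0"
      using insert.prems(3,4) insert.hyps by (auto simp: g_def extensional_def)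
    show "countable {c. g (x(j := c)) = 0}" if "j \<in> I" "g x \<noteq> 0" for j x
    proof -
      have "j \<noteq> i" using that insert.hyps by auto
      then have twist: "(x(j := c))(i := x0 i) = (x(i := x0 i))(j := c)" for c
        by (rule fun_upd_twist)
      have "j \<in> insert i I" "f (x(i := x0 i)) \<noteq> 0"
        using that unfolding g_def by auto
      then show ?thesis
        unfolding g_def twist by (rule insert.prems(5))
    qed
  qed (use insert.prems(1) in auto)
  then have "AE x in Pi\<^sub>M I D. AE c in D i. f (x(i := c)) \<noteq> 0"
  proof eventually_elim
    case (elim x)
    \<comment> \<open>The value \<open>x0 i\<close> is a non-zero of \<open>f\<close> on the line
      through \<open>x\<close> in direction \<open>i\<close>, so this line has only countably many
      zeros.\<close>
    then have "f (x(i := x0 i)) \<noteq> 0"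
      unfolding g_def .
    with insertI1 have "countable {c. f ((x(i := x0 i))(i := c)) = 0}"
      by (rule insert.prems(5))
    then have "countable {c. f (x(i := c)) = 0}"
      by simp
    then have "AE c in D i. c \<notin> {c. f (x(i := c)) = 0}"
      by (rule AE_discrete_difference) (use insert.prems(1) borel in auto)
    then show ?case by simp
  qed
  moreover have "{x \<in> space (Pi\<^sub>M (insert i I) D). \<not> f x \<noteq> 0} \<in> sets (Pi\<^sub>M (insert i I) D)"
  proof -
    have "f \<in> borel_measurable (Pi\<^sub>M (insert i I) D)"
      using insert.prems(2) by (simp add: measurable_PiM)
    then have "f -` {0} \<inter> space (Pi\<^sub>M (insert i I) D) \<in> sets (Pi\<^sub>M (insert i I) D)"
      by (rule measurable_sets) simp
    then show ?thesis
      by (auto elim!: back_subst[of "\<lambda>S. S \<in> _"])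
  qed
  ultimately show ?case
    using insert.hyps by (intro prod.AE_PiM_insertI)
qed

text \<open>By independence the joint law of the \<open>X i\<close> is the product of their laws, so
  the result for product measures pulls back to \<open>M\<close>. This description of the joint law
  is for nonempty \<open>I\<close>.\<close>

lemma (in prob_space) AE_indep_vars_nonzero:
  fixes f :: "('i \<Rightarrow> 'b :: t1_space) \<Rightarrow> 'c :: {t1_space, zero}"
  assumes "finite I" "I \<noteq> {}"
    and indep: "indep_vars (\<lambda>_. borel) X I"
    and null: "\<And>i c. i \<in> I \<Longrightarrow> emeasure (distr M borel (X i)) {c} = 0"
    and f: "f \<in> borel_measurable (Pi\<^sub>M I (\<lambda>_. borel))"
    and x0: "x0 \<in> extensional I" "f x0 \<noteq> 0"
    and countable: "\<And>i x. i \<in> I \<Longrightarrow> f x \<noteq> 0 \<Longrightarrow> countable {c. f (x(i := c)) = 0}"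
  shows "AE \<omega> in M. f (\<lambda>i\<in>I. X i \<omega>) \<noteq> 0"
proof -
  have X: "random_variable borel (X i)" if "i \<in> I" for i
    using indep that by (auto simp: indep_vars_def)
  obtain \<omega>0 where \<omega>0: "\<omega>0 \<in> space M" using not_empty by blast
  \<comment> \<open>The point mass outside \<open>I\<close> is a filler that makes every
    \<open>D i\<close> a probability measure on the Borel sets.\<close>
  define D where "D i = (if i \<in> I then distr M borel (X i) else return borel undefined)" for i
  have "AE x in Pi\<^sub>M I D. f x \<noteq> 0"
  proof (rule AE_PiM_nonzero[OF \<open>finite I\<close> _ _ _ f x0 countable])
    show "prob_space (D i)" for i
      using X by (auto simp: D_def intro: prob_space_distr prob_space_return)
  qed (auto simp: D_def null)
  also have "Pi\<^sub>M I D = Pi\<^sub>M I (\<lambda>i. distr M borel (X i))"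
    by (intro PiM_cong) (auto simp: D_def)
  also have "\<dots> = distr M (Pi\<^sub>M I (\<lambda>_. borel)) (\<lambda>\<omega>. \<lambda>i\<in>I. X i \<omega>)"
    using indep_vars_iff_distr_eq_PiM'[OF \<open>I \<noteq> {}\<close>, where M' = "\<lambda>_. borel" and X = X] X indep by simp
  finally show ?thesis
    by (rule AE_distrD[rotated]) (intro measurable_restrict X)
qed

section \<open>Determinants and matchings\<close>

text \<open>A determinant is affine in any single entry, and an affine function with two distinct
  zeros over an integral domain is identically zero.\<close>

lemma det_eq_0_if_two_entry_values:
  fixes A B C :: "'a :: idom mat"
  assumes carrier: "A \<in> carrier_mat n n" "B \<in> carrier_mat n n" "C \<in> carrier_mat n n"
    and ij: "i < n" "j < n"
    and off: "\<And>k l. k < n \<Longrightarrow> l < n \<Longrightarrow> (k, l) \<noteq> (i, j) \<Longrightarrow> A $$ (k, l) = C $$ (k, l)"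
             "\<And>k l. k < n \<Longrightarrow> l < n \<Longrightarrow> (k, l) \<noteq> (i, j) \<Longrightarrow> B $$ (k, l) = C $$ (k, l)"
    and "A $$ (i, j) \<noteq> B $$ (i, j)"
    and "Determinant.det A = 0" "Determinant.det B = 0"
  shows "Determinant.det C = 0"
proof -
  \<comment> \<open>The constant term of the affine function: cofactors along row \<open>i\<close>
    ignore that row, so \<open>R\<close> and the slope \<open>cofactor C i j\<close> are common to
    all three matrices.\<close>
  define R where "R = (\<Sum>l\<in>{..<n} - {j}. C $$ (i, l) * cofactor C i l)"
  have expand: "Determinant.det X = X $$ (i, j) * cofactor C i j + R"
    if X: "X \<in> carrier_mat n n"
      and eq: "\<And>k l. k < n \<Longrightarrow> l < n \<Longrightarrow> (k, l) \<noteq> (i, j) \<Longrightarrow> X $$ (k, l) = C $$ (k, l)" for X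
  proof -
    have "mat_delete X i l = mat_delete C i l" for l
      using X carrier(3) unfolding mat_delete_def by (intro eq_matI) (auto simp: eq)
    then have cof: "cofactor X i l = cofactor C i l" for l
      by (simp add: Determinant.cofactor_def)
    have "Determinant.det X = (\<Sum>l<n. X $$ (i, l) * cofactor C i l)"
      using laplace_expansion_row[OF X ij(1)] by (simp add: cof)
    also have "\<dots> = X $$ (i, j) * cofactor C i j + (\<Sum>l\<in>{..<n} - {j}. X $$ (i, l) * cofactor C i l)"
      using ij by (intro sum.remove) auto
    also have "(\<Sum>l\<in>{..<n} - {j}. X $$ (i, l) * cofactor C i l) = R"
      unfolding R_def using ij by (intro sum.cong) (auto simp: eq)
    finally show ?thesis .
  qed
  have A: "Determinant.det A = A $$ (i, j) * cofactor C i j + R"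
    using carrier(1) off(1) by (rule expand)
  have B: "Determinant.det B = B $$ (i, j) * cofactor C i j + R"
    using carrier(2) off(2) by (rule expand)
  have "(A $$ (i, j) - B $$ (i, j)) * cofactor C i j = Determinant.det A - Determinant.det B"
    unfolding A B by (simp add: algebra_simps)
  then have "cofactor C i j = 0"
    using assms by simp
  then show ?thesis
    using A expand[OF carrier(3)] assms(9) by simp
qed

text \<open>No edge lies within \<open>V1\<close>, so every vertex of \<open>V1 - {p}\<close> has
  its partner in \<open>V2\<close>. Partners are distinct, and by cardinality they exhaust
  \<open>V2\<close>. Listing the partners in the order of \<open>us\<close> puts the matching on the
  diagonal of the block.\<close>

lemma perfect_matching_lists:
  assumes G: "semi_bipartite G V1 V2"
    and card: "card V1 = card V2 + 1"
    and p: "p \<in> V1"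
    and F: "perfect_matching (delete_vertex G p) F"
  obtains us vs where "distinct us" "set us = V1 - {p}" "distinct vs" "set vs = V2"
    "length us = length vs"
    "\<And>i j. i < length us \<Longrightarrow> j < length us \<Longrightarrow> {us ! i, vs ! j} \<in> F \<longleftrightarrow> i = j"
proof -
  have fin: "finite V1" "finite V2"
    using G by (auto simp: semi_bipartite_def finite_graph_def)
  have disj: "e = e'" if "e \<in> F" "e' \<in> F" "v \<in> e" "v \<in> e'" for e e' v
    using F that by (auto simp: perfect_matching_def disjoint_def)
  have "\<exists>v\<in>V2. {u, v} \<in> F" if u: "u \<in> V1 - {p}" for u
  proof -
    have "u \<in> \<Union>F"
      using F u G by (auto simp: perfect_matching_def delete_vertex_def semi_bipartite_def)
    then obtain e where e: "e \<in> F" "u \<in> e" by auto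
    then have "e \<in> edges G"
      using F by (auto simp: perfect_matching_def delete_vertex_def)
    moreover from this obtain a b where "e = {a, b}" "a \<in> V1 \<union> V2" "b \<in> V1 \<union> V2"
      using G unfolding semi_bipartite_def finite_graph_def by metis
    ultimately obtain v where v: "e = {u, v}" "v \<in> V1 \<union> V2" "{u, v} \<in> edges G"
      using e(2) by (metis empty_iff insert_commute insert_iff)
    then have "v \<notin> V1"
      using u G by (auto simp: semi_bipartite_def)
    with v e(1) show ?thesis by auto
  qed
  then obtain s where s: "s u \<in> V2" "{u, s u} \<in> F" if "u \<in> V1 - {p}" for u
    by metis
  have eq_iff: "{u, s u'} \<in> F \<longleftrightarrow> u = u'" if u: "u \<in> V1 - {p}" "u' \<in> V1 - {p}" for u u'
  proof
    assume "{u, s u'} \<in> F"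
    then have "{u, s u'} = {u', s u'}"
      using disj[of "{u, s u'}" "{u', s u'}" "s u'"] s(2)[OF u(2)] by simp
    then show "u = u'"
      by (auto simp: doubleton_eq_iff)
  qed (use s u in auto)
  have inj: "inj_on s (V1 - {p})"
    using eq_iff s(2) by (metis inj_onI)
  have "s ` (V1 - {p}) = V2"
    using fin inj card p s(1) by (intro card_subset_eq) (auto simp: card_image)
  moreover obtain us where us: "set us = V1 - {p}" "distinct us"
    using finite_distinct_list[of "V1 - {p}"] fin by auto
  moreover have "{us ! i, map s us ! j} \<in> F \<longleftrightarrow> i = j" if "i < length us" "j < length us" for i j
    using eq_iff[of "us ! i" "us ! j"] us nth_mem[OF that(1)] nth_mem[OF that(2)] that
    by (simp add: nth_eq_iff_index_eq)
  ultimately show ?thesis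
    using inj by (intro that[of us "map s us"]) (simp_all add: distinct_map)
qed

text \<open>In block form the matrix is \<open>[[0, B], [B*, C]]\<close> with \<open>B*\<close> the
  conjugate transpose of \<open>B\<close> and \<open>C\<close> arbitrary. For a kernel vector
  \<open>(a, b)\<close> the upper rows give \<open>B b = 0\<close>, so \<open>b = 0\<close>; the
  lower rows then give \<open>B* a = 0\<close>, so \<open>a = 0\<close>.\<close>

lemma det_bipartite_block_nonzero:
  fixes w :: "'v \<Rightarrow> 'v \<Rightarrow> complex"
  assumes us: "distinct us" "set us = U1" "distinct vs" "set vs = U2"
    and len: "length us = n" "length vs = n"
    and disj: "U1 \<inter> U2 = {}"
    and ws: "distinct ws" "set ws = U1 \<union> U2"
    and zero: "\<And>u v. u \<in> U1 \<Longrightarrow> v \<in> U1 \<Longrightarrow> w u v = 0"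
    and herm: "\<And>u v. u \<in> U1 \<Longrightarrow> v \<in> U2 \<Longrightarrow> w v u = cnj (w u v)"
    and det: "Determinant.det (Matrix.mat n n (\<lambda>(i, j). w (us ! i) (vs ! j))) \<noteq> 0"
  shows "Determinant.det (adjacency_matrix ws w) \<noteq> 0"
proof
  define N where "N = length ws"
  define B where "B = Matrix.mat n n (\<lambda>(i, j). w (us ! i) (vs ! j))"
  have B: "B \<in> carrier_mat n n" by (simp add: B_def)
  have kernel: "y = 0\<^sub>v n" if "C \<in> carrier_mat n n" "Determinant.det C \<noteq> 0" "y \<in> carrier_vec n"
      "C *\<^sub>v y = 0\<^sub>v n" for C and y :: "complex Matrix.vec"
    using det_0_iff_vec_prod_zero[of C n] that by auto
  have fin: "finite U1" "finite U2"
    using us by auto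
  have sum_list: "(\<Sum>z\<in>set zs. g z) = (\<Sum>i<length zs. g (zs ! i))" if "distinct zs"
    for zs and g :: "'v \<Rightarrow> complex"
    using bij_betw_nth[OF that refl refl] by (intro sum.reindex_bij_betw[symmetric])
  assume "Determinant.det (adjacency_matrix ws w) = 0"
  then obtain x where x: "x \<in> carrier_vec N" "x \<noteq> 0\<^sub>v N" "adjacency_matrix ws w *\<^sub>v x = 0\<^sub>v N"
    using det_0_iff_vec_prod_zero[of "adjacency_matrix ws w" N]
    by (auto simp: adjacency_matrix_def N_def)
  \<comment> \<open>The order \<open>ws\<close> may interleave the two parts; reading the kernel
    vector as a function on vertices allows sums over \<open>U1\<close> and \<open>U2\<close>
    separately.\<close>
  define \<phi> :: "'v \<Rightarrow> complex" where "\<phi> z = x $ the_inv_into {..<N} ((!) ws) z" for z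
  have inj: "inj_on ((!) ws) {..<N}"
    using ws by (auto simp: N_def inj_on_nth)
  have \<phi>: "\<phi> (ws ! j) = x $ j" if "j < N" for j
    using the_inv_into_f_f[OF inj, of j] that by (simp add: \<phi>_def)
  have row: "(\<Sum>z\<in>U1. w u z * \<phi> z) + (\<Sum>z\<in>U2. w u z * \<phi> z) = 0" if u: "u \<in> U1 \<union> U2" for u
  proof -
    obtain i where i: "i < N" "u = ws ! i"
      using u ws by (metis N_def in_set_conv_nth)
    have "0 = (adjacency_matrix ws w *\<^sub>v x) $ i"
      using x i by simp
    also have "\<dots> = (\<Sum>j<N. w u (ws ! j) * x $ j)"
      using i x(1) by (auto simp: adjacency_matrix_def scalar_prod_def N_def atLeast0LessThan)
    also have "\<dots> = (\<Sum>z\<in>set ws. w u z * \<phi> z)"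
      by (subst sum_list) (auto simp: ws N_def[symmetric] \<phi> intro!: sum.cong)
    also have "\<dots> = (\<Sum>z\<in>U1. w u z * \<phi> z) + (\<Sum>z\<in>U2. w u z * \<phi> z)"
      using disj fin by (simp add: ws sum.union_disjoint)
    finally show ?thesis ..
  qed
  have U2: "\<phi> z = 0" if z: "z \<in> U2" for z
  proof -
    define y where "y = Matrix.vec n (\<lambda>j. \<phi> (vs ! j))"
    have "B *\<^sub>v y = 0\<^sub>v n"
    proof (rule eq_vecI)
      fix i assume "i < dim_vec (0\<^sub>v n :: complex Matrix.vec)"
      then have i: "i < n" by simp
      then have u: "us ! i \<in> U1" using us len by auto
      have "(B *\<^sub>v y) $ i = (\<Sum>j<n. w (us ! i) (vs ! j) * \<phi> (vs ! j))"
        using i by (auto simp: B_def y_def scalar_prod_def atLeast0LessThan)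
      also have "\<dots> = (\<Sum>z\<in>U2. w (us ! i) z * \<phi> z)"
        using sum_list[OF us(3), of "\<lambda>z. w (us ! i) z * \<phi> z"] us len by simp
      also have "\<dots> = 0"
        using row[of "us ! i"] u zero by simp
      finally show "(B *\<^sub>v y) $ i = 0\<^sub>v n $ i" using i by simp
    qed (simp add: B_def)
    then have y0: "y = 0\<^sub>v n"
      using kernel[OF B] det by (simp add: B_def y_def)
    obtain j where j: "j < n" "z = vs ! j"
      using z us len by (metis in_set_conv_nth)
    then have "y $ j = 0" using y0 by simp
    then show ?thesis using j by (simp add: y_def)
  qed
  have U1: "\<phi> z = 0" if z: "z \<in> U1" for z
  proof -
    \<comment> \<open>Conjugating the lower equations turns \<open>B*\<close> into the plain
      transpose of \<open>B\<close>, which has the same determinant as \<open>B\<close>.\<close>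
    define y where "y = Matrix.vec n (\<lambda>j. cnj (\<phi> (us ! j)))"
    have "transpose_mat B *\<^sub>v y = 0\<^sub>v n"
    proof (rule eq_vecI)
      fix i assume "i < dim_vec (0\<^sub>v n :: complex Matrix.vec)"
      then have i: "i < n" by simp
      then have v: "vs ! i \<in> U2" using us len by auto
      have "(transpose_mat B *\<^sub>v y) $ i = (\<Sum>j<n. w (us ! j) (vs ! i) * cnj (\<phi> (us ! j)))"
        using i by (auto simp: B_def y_def scalar_prod_def atLeast0LessThan)
      also have "\<dots> = (\<Sum>z\<in>U1. w z (vs ! i) * cnj (\<phi> z))"
        using sum_list[OF us(1), of "\<lambda>z. w z (vs ! i) * cnj (\<phi> z)"] us len by simp
      also have "\<dots> = cnj (\<Sum>z\<in>U1. w (vs ! i) z * \<phi> z)"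
        using v herm by (simp add: cnj_sum)
      also have "\<dots> = 0"
        using row[of "vs ! i"] v U2 by simp
      finally show "(transpose_mat B *\<^sub>v y) $ i = 0\<^sub>v n $ i" using i by simp
    qed (simp add: B_def)
    then have y0: "y = 0\<^sub>v n"
      using kernel[of "transpose_mat B" y] det B det_transpose[OF B] by (simp add: B_def y_def)
    obtain j where j: "j < n" "z = us ! j"
      using z us len by (metis in_set_conv_nth)
    then have "y $ j = 0" using y0 by simp
    then show ?thesis using j by (simp add: y_def)
  qed
  have "x = 0\<^sub>v N"
  proof (rule eq_vecI)
    fix j assume "j < dim_vec (0\<^sub>v N :: complex Matrix.vec)"
    then have j: "j < N" by simp
    then have "ws ! j \<in> U1 \<union> U2" using ws by (metis N_def nth_mem)
    then show "x $ j = 0\<^sub>v N $ j"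
      using \<phi>[OF j] U1 U2 j by auto
  qed (use x in simp)
  with x show False by simp
qed

section \<open>Application to the random weights\<close>

theorem theorem12:
  fixes M :: "'w measure"
    and G :: "'v graph"
    and V1 V2 P :: "'v set"
    and w :: "'w \<Rightarrow> 'v \<Rightarrow> 'v \<Rightarrow> complex"
  assumes "semi_bipartite G V1 V2"
    and "card V1 = card V2 + 1"
    and "P \<subseteq> V1"
    and "\<And>p. p \<in> P \<Longrightarrow> \<exists>F. perfect_matching (delete_vertex G p) F"
    and "random_weights M G w"
  shows "AE \<omega> in M. \<forall>p\<in>P. \<forall>vs. vertex_list (delete_vertex G p) vs \<longrightarrow>
           Determinant.det (adjacency_matrix vs (w \<omega>)) \<noteq> 0"
proof -
  interpret prob_space M
    using assms(5) by (simp add: random_weights_def)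
  have fin: "finite V1" "finite V2" and V: "verts G = V1 \<union> V2" "V1 \<inter> V2 = {}"
    and no_edge: "\<And>u v. u \<in> V1 \<Longrightarrow> v \<in> V1 \<Longrightarrow> {u, v} \<notin> edges G"
    using assms(1) by (auto simp: semi_bipartite_def finite_graph_def)
  have "edges G \<subseteq> Pow (verts G)"
    using assms(1) by (force simp: semi_bipartite_def finite_graph_def)
  then have fin_edges: "finite (edges G)"
    using fin V by (metis finite_Pow_iff finite_Un finite_subset)
  have hermitian: "\<forall>\<omega>\<in>space M. hermitian_weights G (w \<omega>)"
    and continuous: "\<forall>u v. {u, v} \<in> edges G \<longrightarrow>
        continuous_distribution (distr M borel (\<lambda>\<omega>. w \<omega> u v))"
    using assms(5) unfolding random_weights_def by fast+
  obtain ends where ends_all: "\<forall>e\<in>edges G. e = {fst (ends e), snd (ends e)}"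
    and indep: "indep_vars (\<lambda>e. borel) (\<lambda>e \<omega>. w \<omega> (fst (ends e)) (snd (ends e))) (edges G)"
    using assms(5) unfolding random_weights_def by (elim conjE exE) (rule that)
  note ends = bspec[OF ends_all]
  define X where "X e \<omega> = w \<omega> (fst (ends e)) (snd (ends e))" for e \<omega>
  have null: "emeasure (distr M borel (X e)) {c} = 0" if e: "e \<in> edges G" for e c
  proof -
    have "{fst (ends e), snd (ends e)} \<in> edges G"
      using ends[OF e, symmetric] e by (rule ssubst)
    then show ?thesis
      using continuous by (simp add: continuous_distribution_def X_def[abs_def])
  qed
  have herm: "hermitian_weights G (w \<omega>)" if "\<omega> \<in> space M" for \<omega>
    using hermitian that by blast

  have "AE \<omega> in M. \<forall>ws. vertex_list (delete_vertex G p) ws \<longrightarrow>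
           Determinant.det (adjacency_matrix ws (w \<omega>)) \<noteq> 0" if p: "p \<in> P" for p
  proof -
    obtain F where F: "perfect_matching (delete_vertex G p) F"
      using assms(4)[OF p] by blast
    have "p \<in> V1" using p assms(3) by auto
    then obtain us vs where us: "distinct us" "set us = V1 - {p}" "distinct vs" "set vs = V2"
      "length us = length vs"
      and matching: "\<And>i j. i < length us \<Longrightarrow> j < length us \<Longrightarrow> {us ! i, vs ! j} \<in> F \<longleftrightarrow> i = j"
      using perfect_matching_lists[OF assms(1,2) _ F] by metis
    define n where "n = length us"
    have us_in: "us ! i \<in> V1" and vs_in: "vs ! i \<in> V2" if "i < n" for i
      using us that nth_mem[of i us] nth_mem[of i vs] by (auto simp: n_def)
    \<comment> \<open>Distinct positions of the block carry distinct edges, since \<open>V1\<close>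
      and \<open>V2\<close> are disjoint; so changing the value of one edge changes at most one
      entry.\<close>
    have edge_inj: "i = i' \<and> j = j'"
      if "i < n" "j < n" "i' < n" "j' < n" "{us ! i, vs ! j} = {us ! i', vs ! j'}" for i j i' j'
    proof -
      have "us ! i \<noteq> vs ! j'"
        using us_in[OF that(1)] vs_in[OF that(4)] V by auto
      then have "us ! i = us ! i'" "vs ! j = vs ! j'"
        using that(5) by (auto simp: doubleton_eq_iff)
      then show ?thesis
        using that us by (simp add: n_def nth_eq_iff_index_eq)
    qed

    text \<open>The orientation may pick the weight from \<open>V2\<close> to \<open>V1\<close>, which is then conjugated.\<close>
    define entry where "entry u v y = (if {u, v} \<in> edges G then
        if ends {u, v} = (u, v) then y {u, v} else cnj (y {u, v}) else 0)"
      for u v and y :: "'v set \<Rightarrow> complex"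
    \<comment> \<open>The block as a deterministic function of one value per edge, so that
      randomness enters only through the independent family \<open>X\<close>.\<close>
    define B where "B y = Matrix.mat n n (\<lambda>(i, j). entry (us ! i) (vs ! j) y)" for y
    have B: "B y \<in> carrier_mat n n" for y by (simp add: B_def)
    have entry_w: "entry (us ! i) (vs ! j) (\<lambda>e\<in>edges G. X e \<omega>) = w \<omega> (us ! i) (vs ! j)"
      if ij: "i < n" "j < n" and \<omega>: "\<omega> \<in> space M" for i j \<omega>
    proof (cases "{us ! i, vs ! j} \<in> edges G")
      case True
      obtain a b where ab: "ends {us ! i, vs ! j} = (a, b)"
        by fastforce
      have "{us ! i, vs ! j} = {a, b}"
        using ends[OF True] unfolding ab fst_conv snd_conv .
      then have "ends {us ! i, vs ! j} = (us ! i, vs ! j) \<or> ends {us ! i, vs ! j} = (vs ! j, us ! i)"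
        unfolding ab by (auto simp: doubleton_eq_iff)
      moreover have "w \<omega> (us ! i) (vs ! j) = cnj (w \<omega> (vs ! j) (us ! i))"
        using herm[OF \<omega>] us_in[OF ij(1)] vs_in[OF ij(2)] V unfolding hermitian_weights_def by blast
      ultimately show ?thesis
        using True by (auto simp: entry_def X_def)
    next
      case False
      then have "w \<omega> (us ! i) (vs ! j) = 0"
        using herm[OF \<omega>] us_in[OF ij(1)] vs_in[OF ij(2)] V unfolding hermitian_weights_def by blast
      with False show ?thesis
        by (simp add: entry_def)
    qed

    have "AE \<omega> in M. Determinant.det (B (\<lambda>e\<in>edges G. X e \<omega>)) \<noteq> 0"
    proof (cases "edges G = {}")
      case True
      \<comment> \<open>Without edges the matching is empty, hence so is its diagonal; the
        determinant of the empty block is 1.\<close>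
      then have "n = 0"
        using F matching[of 0 0] by (auto simp: perfect_matching_def delete_vertex_def n_def)
      then show ?thesis
        by (simp add: B_def)
    next
      case False
      show ?thesis
      proof (rule AE_indep_vars_nonzero[OF fin_edges False _ null])
        show "indep_vars (\<lambda>_. borel) X (edges G)"
          using indep by (simp add: X_def[abs_def])
        show "(\<lambda>y. Determinant.det (B y)) \<in> borel_measurable (Pi\<^sub>M (edges G) (\<lambda>_. borel))"
        proof -
          have cnj: "cnj \<in> borel_measurable borel"
            by (intro borel_measurable_continuous_onI continuous_intros)
          have entry: "(\<lambda>y. entry u v y) \<in> borel_measurable (Pi\<^sub>M (edges G) (\<lambda>_. borel))" for u v
            unfolding entry_def
            by (cases "{u, v} \<in> edges G"; cases "ends {u, v} = (u, v)")
               (auto intro!: measurable_component_singleton measurable_compose[OF _ cnj])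
          \<comment> \<open>The Leibniz formula writes the determinant as a polynomial in the
            entries, which gives measurability.\<close>
          have "Determinant.det (B y) = (\<Sum>q | q permutes {0..<n}.
              signof q * (\<Prod>i = 0..<n. entry (us ! i) (vs ! q i) y))" for y
            unfolding det_def'[OF B]
            by (intro sum.cong refl arg_cong2[where f = times] prod.cong)
               (auto simp: B_def dest: permutes_in_image)
          then show ?thesis
            by (simp only:) (intro borel_measurable_sum borel_measurable_times borel_measurable_const
                borel_measurable_prod entry)
        qed
        \<comment> \<open>The starting weights are the indicator of the matching. Being real, they
          are unaffected by the orientation of the edges.\<close>
        define y0 where "y0 = (\<lambda>e\<in>edges G. if e \<in> F then 1 else 0 :: complex)"
        show "y0 \<in> extensional (edges G)" by (simp add: y0_def)
        have "entry (us ! i) (vs ! j) y0 = (if i = j then 1 else 0)" if "i < n" "j < n" for i j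
          using that matching[of i j] F
          by (auto simp: entry_def y0_def n_def perfect_matching_def delete_vertex_def)
        then have "B y0 = 1\<^sub>m n"
          by (intro eq_matI) (auto simp: B_def)
        then show "Determinant.det (B y0) \<noteq> 0" by simp
        show "countable {c. Determinant.det (B (y(e := c))) = 0}"
          if e: "e \<in> edges G" and nz: "Determinant.det (B y) \<noteq> 0" for e y
        proof -
          have "c = c'" if c: "Determinant.det (B (y(e := c))) = 0" "Determinant.det (B (y(e := c'))) = 0"
            for c c'
          proof (rule ccontr)
            assume "c \<noteq> c'"
            show False
            proof (cases "\<exists>i<n. \<exists>j<n. e = {us ! i, vs ! j}")
              case True
              then obtain i j where ij: "i < n" "j < n" "e = {us ! i, vs ! j}" by blast
              have off: "B (y(e := a)) $$ (k, l) = B y $$ (k, l)"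
                if "k < n" "l < n" "(k, l) \<noteq> (i, j)" for a k l
                using that edge_inj[of k l i j] ij by (auto simp: B_def entry_def)
              \<comment> \<open>The entry is the edge value or its conjugate, and conjugation is
                injective. Two zeros \<open>c \<noteq> c'\<close> would thus force
                \<open>det (B y) = 0\<close>.\<close>
              have "B (y(e := c)) $$ (i, j) \<noteq> B (y(e := c')) $$ (i, j)"
                using ij e \<open>c \<noteq> c'\<close> by (auto simp: B_def entry_def)
              then show False
                using det_eq_0_if_two_entry_values[OF B B B ij(1,2) off off _ c] nz by simp
            next
              case False
              then have "B (y(e := c)) = B y"
                by (intro eq_matI) (auto simp: B_def entry_def)
              then show False using c nz by simp
            qed
          qed
          then have "\<exists>c. {c. Determinant.det (B (y(e := c))) = 0} \<subseteq> {c}" by blast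
          then show ?thesis by (meson countable_empty countable_insert countable_subset)
        qed
      qed
    qed
    with AE_space show ?thesis
    proof eventually_elim
      case (elim \<omega>)
      have "B (\<lambda>e\<in>edges G. X e \<omega>) = Matrix.mat n n (\<lambda>(i, j). w \<omega> (us ! i) (vs ! j))"
        using elim(1) by (intro eq_matI) (auto simp: B_def entry_w)
      with elim(2) have det: "Determinant.det (Matrix.mat n n (\<lambda>(i, j). w \<omega> (us ! i) (vs ! j))) \<noteq> 0"
        by simp
      show ?case
      \<comment> \<open>The exceptional null set was fixed by the block for \<open>p\<close> alone,
        so one \<omega> serves all vertex orders \<open>ws\<close> at once.\<close>
      proof (intro allI impI)
        fix ws assume "vertex_list (delete_vertex G p) ws"
        then have ws: "distinct ws" "set ws = (V1 - {p}) \<union> V2"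
          using V \<open>p \<in> V1\<close> by (auto simp: vertex_list_def delete_vertex_def)
        have h: "w \<omega> u v = cnj (w \<omega> v u)" "{u, v} \<notin> edges G \<Longrightarrow> w \<omega> u v = 0"
          if "u \<in> V1 \<union> V2" "v \<in> V1 \<union> V2" for u v
          using herm[OF elim(1)] that unfolding hermitian_weights_def V by blast+
        show "Determinant.det (adjacency_matrix ws (w \<omega>)) \<noteq> 0"
        proof (rule det_bipartite_block_nonzero[OF us(1-4) _ _ _ ws _ _ det])
          show "length us = n" "length vs = n"
            using us(5) by (simp_all add: n_def)
          show "(V1 - {p}) \<inter> V2 = {}" using V by auto
          show "w \<omega> u v = 0" if "u \<in> V1 - {p}" "v \<in> V1 - {p}" for u v
            using h(2)[of u v] no_edge[of u v] that by auto
          show "w \<omega> v u = cnj (w \<omega> u v)" if "u \<in> V1 - {p}" "v \<in> V2" for u v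
            using h(1)[of v u] that by auto
        qed
      qed
    qed
  qed
  \<comment> \<open>Finitely many null sets, one for each \<open>p\<close>, have a null
    union.\<close>
  moreover have "finite P" using assms(3) fin(1) by (rule finite_subset)
  ultimately show ?thesis by (simp add: AE_finite_all)
qed

end
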